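(* Suppose that $E$ and $F$ are ordered Banach spaces, $C$ is an open convex subset of $E$ and $\Phi:C\to F$ is a differentiable convex function whose differential is isotone on $C$. Then for every family of points $\mathbf{x}_1,\mathbf{x}_2,\mathbf{y}_1,\mathbf{y}_2$ in $C$ and any $\lambda\in(0,1)$ such that $$\mathbf{y}_2\le\mathbf{x}_2\le(1-\lambda)\mathbf{y}_1+\lambda\mathbf{y}_2\le\mathbf{x}_1\le\mathbf{y}_1,$$ we have $$0\le(1-\lambda)\Phi(\mathbf{x}_1)+\lambda\Phi(\mathbf{x}_2)-\Phi\bigl((1-\lambda)\mathbf{x}_1+\lambda\mathbf{x}_2\bigr)\le(1-\lambda)\Phi(\mathbf{y}_1)+\lambda\Phi(\mathbf{y}_2)-\Phi\bigl((1-\lambda)\mathbf{y}_1+\lambda\mathbf{y}_2\bigr).$$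
   Context: An ordered Banach space is a real Banach space $E$ with the partial order $\mathbf{x}\le\mathbf{y}\iff\mathbf{y}-\mathbf{x}\in E_+$ given by a closed proper convex cone $E_+$. Differentiable means Gâteaux differentiable, with $\Phi'(\mathbf{a}):E\to F$ a bounded linear operator. Convexity of $\Phi$ is with respect to the order of $F$: $\Phi((1-\lambda)\mathbf{x}+\lambda\mathbf{y})\le(1-\lambda)\Phi(\mathbf{x})+\lambda\Phi(\mathbf{y})$. The differential is isotone on $C$ if $\mathbf{a}\le\mathbf{b}$ in $C$ implies $\Phi'(\mathbf{a})\mathbf{v}\le\Phi'(\mathbf{b})\mathbf{v}$ for all $\mathbf{v}\in E_+$. *)

theory Defs
  imports "HOL-Analysis.Analysis"
begin

text \<open>
  The order is primitive here. The class axioms say exactly that it is the order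
  \<open>x \<le> y \<longleftrightarrow> y - x \<in> positive_cone\<close> induced by a closed convex cone containing \<open>0\<close> that meets
  its negative only in \<open>0\<close>; the facts \<open>le_iff_diff_positive_cone\<close>, \<open>convex_positive_cone\<close>,
  \<open>conic_positive_cone\<close> and \<open>proper_positive_cone\<close> below record this. Neither normality of the
  cone nor \<open>E = positive_cone - positive_cone\<close> is required.
\<close>

class ordered_banach = banach + ordered_real_vector +
  assumes closed_nonneg: "closed {x. 0 \<le> x}"

instance real :: ordered_banach
  by standard (simp flip: atLeast_def)

definition positive_cone :: "'a::ordered_banach set"
  where "positive_cone = {x. 0 \<le> x}"

lemma le_iff_diff_positive_cone: "x \<le> y \<longleftrightarrow> y - x \<in> positive_cone"
  by (simp add: positive_cone_def)

lemma closed_positive_cone: "closed positive_cone"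
  by (simp add: positive_cone_def closed_nonneg)

lemma convex_positive_cone: "convex positive_cone"
  by (auto simp: positive_cone_def convex_def intro!: add_nonneg_nonneg scaleR_nonneg_nonneg)

lemma conic_positive_cone: "0 \<le> c \<Longrightarrow> x \<in> positive_cone \<Longrightarrow> c *\<^sub>R x \<in> positive_cone"
  by (simp add: positive_cone_def scaleR_nonneg_nonneg)

lemma proper_positive_cone: "positive_cone \<inter> uminus ` positive_cone = {0}"
  by (auto simp: positive_cone_def)

text \<open>
  The limit is two-sided in \<open>t\<close>. A function on an open set \<open>C\<close> is represented by a total
  function; at a point of \<open>C\<close> the limit depends only on the values taken on \<open>C\<close>.
\<close>

definition has_gateaux_derivative ::
    "('a::real_normed_vector \<Rightarrow> 'b::real_normed_vector) \<Rightarrow> ('a \<Rightarrow> 'b) \<Rightarrow> 'a \<Rightarrow> bool"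
  where "has_gateaux_derivative f D a \<longleftrightarrow>
    bounded_linear D \<and>
    (\<forall>v. ((\<lambda>t::real. (f (a + t *\<^sub>R v) - f a) /\<^sub>R t) \<longlongrightarrow> D v) (at 0))"

lemma has_gateaux_derivative_unique:
  assumes "has_gateaux_derivative f D a" "has_gateaux_derivative f D' a"
  shows "D = D'"
proof
  fix v
  show "D v = D' v"
    using assms tendsto_unique[OF trivial_limit_at] unfolding has_gateaux_derivative_def by blast
qed

text \<open>The library's \<open>convex_on\<close> covers only real-valued functions.\<close>

definition order_convex_on :: "'a::real_vector set \<Rightarrow> ('a \<Rightarrow> 'b::ordered_real_vector) \<Rightarrow> bool"
  where "order_convex_on C f \<longleftrightarrow>
    convex C \<and>
    (\<forall>x\<in>C. \<forall>y\<in>C. \<forall>l::real. 0 \<le> l \<longrightarrow> l \<le> 1 \<longrightarrow>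
      f ((1 - l) *\<^sub>R x + l *\<^sub>R y) \<le> (1 - l) *\<^sub>R f x + l *\<^sub>R f y)"

definition isotone_differential_on ::
    "'a::ordered_banach set \<Rightarrow> ('a \<Rightarrow> 'a \<Rightarrow> 'b::ordered_banach) \<Rightarrow> bool"
  where "isotone_differential_on C D \<longleftrightarrow>
    (\<forall>a\<in>C. \<forall>b\<in>C. a \<le> b \<longrightarrow> (\<forall>v\<in>positive_cone. D a v \<le> D b v))"

end

theory Submission imports Defs begin

text \<open>
  Write \<open>m\<^sub>x\<close> and \<open>m\<^sub>y\<close> for the means of \<open>x\<^sub>1, x\<^sub>2\<close> and \<open>y\<^sub>1, y\<^sub>2\<close> with weights \<open>1 - l\<close> and \<open>l\<close>.
  The lower bound is convexity of \<open>\<Phi>\<close>. For the upper bound, a convex function lies above its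
  tangents (\<open>order_convex_on_above_tangent\<close>). Taking the tangents at \<open>x\<^sub>1\<close>, \<open>x\<^sub>2\<close> and \<open>m\<^sub>y\<close>, this gives

    \<open>\<Phi> y\<^sub>1 - \<Phi> x\<^sub>1 \<ge> \<Phi>' x\<^sub>1 (y\<^sub>1 - x\<^sub>1)\<close>,  \<open>\<Phi> y\<^sub>2 - \<Phi> x\<^sub>2 \<ge> \<Phi>' x\<^sub>2 (y\<^sub>2 - x\<^sub>2)\<close>,
    \<open>\<Phi> m\<^sub>y - \<Phi> m\<^sub>x \<le> \<Phi>' m\<^sub>y (m\<^sub>y - m\<^sub>x)\<close>.

  The base points of the first two tangents lie on the two sides of \<open>m\<^sub>y\<close>, that is
  \<open>x\<^sub>2 \<le> m\<^sub>y \<le> x\<^sub>1\<close>, while the increments \<open>y\<^sub>1 - x\<^sub>1 \<ge> 0\<close> and \<open>y\<^sub>2 - x\<^sub>2 \<le> 0\<close> have the matching signs.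
  An isotone differential therefore lets both base points be replaced by \<open>m\<^sub>y\<close>, at the cost of
  making the two lower bounds smaller. The operator \<open>\<Phi>' m\<^sub>y\<close> is linear and
  \<open>m\<^sub>y - m\<^sub>x = (1 - l) (y\<^sub>1 - x\<^sub>1) + l (y\<^sub>2 - x\<^sub>2)\<close>, so the weighted sum of these lower bounds is
  exactly the upper bound for \<open>\<Phi> m\<^sub>y - \<Phi> m\<^sub>x\<close>.
\<close>

lemma tendsto_upperbound_ordered_banach:
  fixes f :: "'a \<Rightarrow> 'b::ordered_banach"
  assumes "(f \<longlongrightarrow> L) F" and "eventually (\<lambda>t. f t \<le> c) F" and "F \<noteq> bot"
  shows "L \<le> c"
proof -
  have "eventually (\<lambda>t. c - f t \<in> {x. 0 \<le> x}) F"
    using assms(2) by simp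
  moreover have "((\<lambda>t. c - f t) \<longlongrightarrow> c - L) F"
    using assms(1) by (intro tendsto_intros)
  ultimately have "c - L \<in> {x. 0 \<le> x}"
    by (rule Lim_in_closed_set[OF closed_nonneg _ assms(3)])
  then show ?thesis by simp
qed

text \<open>
  Convexity on the segment from \<open>a\<close> to \<open>y\<close> bounds every difference quotient with step in \<open>(0, 1]\<close>
  by the full increment \<open>f y - f a\<close>; the cone is closed, so the bound survives the limit.
\<close>

lemma order_convex_on_above_tangent:
  fixes f :: "'a::real_normed_vector \<Rightarrow> 'b::ordered_banach"
  assumes conv: "order_convex_on C f" and "a \<in> C" "y \<in> C"
    and deriv: "has_gateaux_derivative f D a"
  shows "D (y - a) \<le> f y - f a"
proof (rule tendsto_upperbound_ordered_banach)
  show "((\<lambda>t. (f (a + t *\<^sub>R (y - a)) - f a) /\<^sub>R t) \<longlongrightarrow> D (y - a)) (at_right 0)"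
    using deriv unfolding has_gateaux_derivative_def
    by (blast intro: tendsto_within_subset)
  have quotient_le: "(f (a + t *\<^sub>R (y - a)) - f a) /\<^sub>R t \<le> f y - f a" if "0 < t" "t < 1" for t :: real
  proof -
    have "a + t *\<^sub>R (y - a) = (1 - t) *\<^sub>R a + t *\<^sub>R y"
      by (simp add: algebra_simps)
    then have "f (a + t *\<^sub>R (y - a)) \<le> (1 - t) *\<^sub>R f a + t *\<^sub>R f y"
      using conv assms(2,3) that by (simp add: order_convex_on_def)
    then have "f (a + t *\<^sub>R (y - a)) - f a \<le> t *\<^sub>R (f y - f a)"
      by (simp add: algebra_simps)
    then show ?thesis
      using that by (simp add: pos_divideR_le_eq)
  qed
  show "\<forall>\<^sub>F t in at_right 0. (f (a + t *\<^sub>R (y - a)) - f a) /\<^sub>R t \<le> f y - f a"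
    using quotient_le by (auto simp: eventually_at_right_field intro!: exI[of _ 1])
qed simp

theorem theorem7:
  fixes C :: "'a::ordered_banach set"
    and \<Phi> :: "'a \<Rightarrow> 'b::ordered_banach"
    and \<Phi>' :: "'a \<Rightarrow> 'a \<Rightarrow> 'b"
    and x1 x2 y1 y2 :: 'a
    and l :: real
  assumes "open C" and "convex C"
    and "\<And>a. a \<in> C \<Longrightarrow> has_gateaux_derivative \<Phi> (\<Phi>' a) a"
    and "order_convex_on C \<Phi>"
    and "isotone_differential_on C \<Phi>'"
    and "x1 \<in> C" and "x2 \<in> C" and "y1 \<in> C" and "y2 \<in> C"
    and "0 < l" and "l < 1"
    and "y2 \<le> x2"
    and "x2 \<le> (1 - l) *\<^sub>R y1 + l *\<^sub>R y2"
    and "(1 - l) *\<^sub>R y1 + l *\<^sub>R y2 \<le> x1"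
    and "x1 \<le> y1"
  shows "0 \<le> (1 - l) *\<^sub>R \<Phi> x1 + l *\<^sub>R \<Phi> x2 - \<Phi> ((1 - l) *\<^sub>R x1 + l *\<^sub>R x2) \<and>
      (1 - l) *\<^sub>R \<Phi> x1 + l *\<^sub>R \<Phi> x2 - \<Phi> ((1 - l) *\<^sub>R x1 + l *\<^sub>R x2)
      \<le> (1 - l) *\<^sub>R \<Phi> y1 + l *\<^sub>R \<Phi> y2 - \<Phi> ((1 - l) *\<^sub>R y1 + l *\<^sub>R y2)"
proof -
  define mx where "mx = (1 - l) *\<^sub>R x1 + l *\<^sub>R x2"
  define my where "my = (1 - l) *\<^sub>R y1 + l *\<^sub>R y2"
  have mC: "mx \<in> C" "my \<in> C"
    using assms unfolding mx_def my_def by (auto intro!: convexD)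
  have lower: "\<Phi> mx \<le> (1 - l) *\<^sub>R \<Phi> x1 + l *\<^sub>R \<Phi> x2"
    using assms unfolding mx_def by (simp add: order_convex_on_def)
  interpret D: bounded_linear "\<Phi>' my"
    using assms(3)[OF mC(2)] by (simp add: has_gateaux_derivative_def)
  interpret D2: bounded_linear "\<Phi>' x2"
    using assms(3)[OF assms(7)] by (simp add: has_gateaux_derivative_def)

  have tangent: "\<Phi>' a (b - a) \<le> \<Phi> b - \<Phi> a" if "a \<in> C" "b \<in> C" for a b
    using order_convex_on_above_tangent[OF assms(4) that assms(3)[OF that(1)]] .

  have "\<Phi>' my (y1 - x1) \<le> \<Phi>' x1 (y1 - x1)"
    using assms mC by (simp add: isotone_differential_on_def positive_cone_def my_def)
  also have "\<dots> \<le> \<Phi> y1 - \<Phi> x1"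
    using tangent assms by simp
  finally have incr1: "\<Phi>' my (y1 - x1) \<le> \<Phi> y1 - \<Phi> x1" .

  \<comment> \<open>Isotonicity applies to \<open>x2 - y2 \<ge> 0\<close>; the sign change reverses the inequality.\<close>
  have "\<Phi>' x2 (x2 - y2) \<le> \<Phi>' my (x2 - y2)"
    using assms mC by (simp add: isotone_differential_on_def positive_cone_def my_def)
  then have "\<Phi>' my (y2 - x2) \<le> \<Phi>' x2 (y2 - x2)"
    by (simp add: D.diff D2.diff algebra_simps)
  also have "\<dots> \<le> \<Phi> y2 - \<Phi> x2"
    using tangent assms by simp
  finally have incr2: "\<Phi>' my (y2 - x2) \<le> \<Phi> y2 - \<Phi> x2" .

  have "\<Phi> my - \<Phi> mx \<le> \<Phi>' my (my - mx)"
    using tangent[OF mC(2,1)] by (simp add: D.diff algebra_simps)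
  also have "my - mx = (1 - l) *\<^sub>R (y1 - x1) + l *\<^sub>R (y2 - x2)"
    by (simp add: mx_def my_def algebra_simps)
  also have "\<Phi>' my \<dots> = (1 - l) *\<^sub>R \<Phi>' my (y1 - x1) + l *\<^sub>R \<Phi>' my (y2 - x2)"
    by (simp only: D.add D.scaleR)
  also have "\<dots> \<le> (1 - l) *\<^sub>R (\<Phi> y1 - \<Phi> x1) + l *\<^sub>R (\<Phi> y2 - \<Phi> x2)"
    using assms incr1 incr2 by (intro add_mono scaleR_left_mono) auto
  finally have "\<Phi> my - \<Phi> mx \<le> (1 - l) *\<^sub>R (\<Phi> y1 - \<Phi> x1) + l *\<^sub>R (\<Phi> y2 - \<Phi> x2)" .
  then have "(1 - l) *\<^sub>R \<Phi> x1 + l *\<^sub>R \<Phi> x2 - \<Phi> mx \<le> (1 - l) *\<^sub>R \<Phi> y1 + l *\<^sub>R \<Phi> y2 - \<Phi> my"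
    by (simp add: algebra_simps)
  with lower show ?thesis
    by (simp add: mx_def my_def)
qed

end
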